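(* Let $m\ge 3$ be an integer and let $(\lambda^{(n)})_{n\ge 1}$ be a sequence of partitions with $\lambda^{(n)}\vdash n$. For each $n$ let $M$ be chosen uniformly at random from $\mathcal{M}_m(n,\lambda^{(n)})$. Then, as $n\to\infty$, \[ \frac{g(M)-\mu_m}{\sigma_m}\longrightarrow\mathcal{N}(0,1) \] in distribution, where \[ \mu_m=\frac{(m-1)n-\ell(\lambda^{(n)})}{2}-\frac{m-1}{2}\ln(n),\qquad \sigma_m^2=\frac{m-1}{4}\ln(n). \]
   Context: $\mathcal{N}(0,1)$ is the standard normal distribution and $\mathbb{S}_n$ is the symmetric group on $n$ letters. For a partition $\lambda\vdash n$, $\ell(\lambda)$ is its number of parts and $C(\lambda)\subset\mathbb{S}_n$ is the conjugacy class of permutations of cycle type $\lambda$. For $\sigma\in\mathbb{S}_n$, $\mathrm{cyc}(\sigma)$ is its number of cycles. $\mathcal{M}_m(n,\lambda)$ is the set of tuples $(\phi,\sigma_0,\ldots,\sigma_{m-1})$ of permutations in $\mathbb{S}_n$ with $\phi\sigma_0\sigma_1\cdots\sigma_{m-1}=\mathrm{id}_n$, $\phi\in C(\lambda)$ and $\sigma_0$ an $n$-cycle. The genus of such a tuple is \[ g(\phi,\sigma_0,\ldots,\sigma_{m-1})=1+\tfrac12\Big((m-1)n-\ell(\lambda)-\sum_{i=0}^{m-1}\mathrm{cyc}(\sigma_i)\Big). \] *)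

theory Defs
  imports "HOL-Probability.Probability" "HOL-Combinatorics.Orbits" "HOL-Combinatorics.Permutations"
begin

definition is_partition :: "nat multiset \<Rightarrow> nat \<Rightarrow> bool" where
  "is_partition lam n \<longleftrightarrow> 0 \<notin># lam \<and> sum_mset lam = n"

text \<open>
  The symmetric group on \<open>n\<close> letters consists of the functions on the natural numbers that
  permute \<open>{1..n}\<close>. Cycles are identified with orbits, so each fixed point in \<open>{1..n}\<close>
  counts as a cycle of length 1.
\<close>

definition sym_group :: "nat \<Rightarrow> (nat \<Rightarrow> nat) set" where
  "sym_group n = {s. s permutes {1..n}}"

definition cycles_of :: "nat \<Rightarrow> (nat \<Rightarrow> nat) \<Rightarrow> nat set set" where
  "cycles_of n s = orbit s ` {1..n}"

definition cyc :: "nat \<Rightarrow> (nat \<Rightarrow> nat) \<Rightarrow> nat" where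
  "cyc n s = card (cycles_of n s)"

definition cycle_type :: "nat \<Rightarrow> (nat \<Rightarrow> nat) \<Rightarrow> nat multiset" where
  "cycle_type n s = image_mset card (mset_set (cycles_of n s))"

definition conj_class :: "nat \<Rightarrow> nat multiset \<Rightarrow> (nat \<Rightarrow> nat) set" where
  "conj_class n lam = {s \<in> sym_group n. cycle_type n s = lam}"

text \<open>
  A tuple \<open>(\<phi>, \<sigma>\<^sub>0, \<dots>, \<sigma>\<^sub>m\<^sub>-\<^sub>1)\<close> is a pair of \<open>\<phi>\<close> and the list of the \<open>\<sigma>\<^sub>i\<close>. Products of
  permutations are compositions of functions. With the opposite convention, inverting every
  entry is a bijection onto this set that preserves all cycle types.
\<close>

definition tuples :: "nat \<Rightarrow> nat \<Rightarrow> nat multiset \<Rightarrow> ((nat \<Rightarrow> nat) \<times> (nat \<Rightarrow> nat) list) set" where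
  "tuples m n lam = {(\<phi>, \<sigma>s).
     length \<sigma>s = m \<and> set \<sigma>s \<subseteq> sym_group n \<and> \<phi> \<in> conj_class n lam \<and>
     cyclic_on (\<sigma>s ! 0) {1..n} \<and>
     \<phi> \<circ> foldr (\<circ>) \<sigma>s id = id}"

definition genus ::
  "nat \<Rightarrow> nat \<Rightarrow> nat multiset \<Rightarrow> (nat \<Rightarrow> nat) \<times> (nat \<Rightarrow> nat) list \<Rightarrow> real" where
  "genus m n lam = (\<lambda>(\<phi>, \<sigma>s).
     1 + 1/2 * ((real m - 1) * real n - real (size lam) - (\<Sum>i<m. real (cyc n (\<sigma>s ! i)))))"

end

(*
  Choose \<phi>, the full cycle \<sigma>_0 and \<sigma>_2, ..., \<sigma>_(m-1) freely; then \<sigma>_1 is the inverse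
  of \<alpha> \<sigma>_0 with \<alpha> = \<sigma>_2 ... \<sigma>_(m-1) \<phi>. So one has to understand cyc (\<alpha> c) for fixed
  \<alpha> and a uniform full cycle c. Removing the letter n from both permutations, one finds by
  induction that cyc (\<alpha> c) is stochastically dominated by X = 1 + B_1 + ... + B_(n-1) with
  independent Bernoulli variables B_j of parameter 1/j, for every \<alpha>. For uniform \<alpha> the product
  \<alpha> c is uniform, so the mean H_n of cyc (\<alpha> c) misses the mean 1 + H_(n-1) of X by less than 1.
  Hence on average over \<alpha> the Wasserstein distance of cyc (\<alpha> c) and X is less than 1, which is
  negligible against sqrt (ln n). In the limit, the cycle counts of \<sigma>_1, ..., \<sigma>_(m-1) thus behave like
  independent sums of Bernoulli variables, and the theorem follows from Levy continuity.
*)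

theory Submission
  imports Defs
begin

section \<open>Removing the last letter of a permutation\<close>

hide_const (open) Finite_Cartesian_Product.transpose

text \<open>Composing with this transposition sends the preimage of \<open>a\<close> straight to
  \<open>\<rho> a\<close> and makes \<open>a\<close> a fixed point, so every other orbit merely
  skips \<open>a\<close>.\<close>

lemma orbit_transpose_comp:
  assumes "inj \<rho>" "x \<noteq> a"
  shows "orbit (transpose a (\<rho> a) \<circ> \<rho>) x = orbit \<rho> x - {a}" (is "orbit ?\<rho> x = _")
proof (intro equalityI subsetI)
  have ne: "\<rho> a \<noteq> a" if "\<rho> y = a" "y \<noteq> a" for y
    using that injD[OF assms(1), of a y] by auto
  fix y assume "y \<in> orbit ?\<rho> x"
  then have "y \<in> orbit \<rho> x \<and> y \<noteq> a"
  proof induction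
    case base
    show ?case
      using assms ne[of x] injD[OF assms(1), of x a]
      by (auto simp: Transposition.transpose_def intro: orbit.intros)
  next
    case (step y)
    then show ?case
      using ne[of y] injD[OF assms(1), of y a]
      by (auto simp: Transposition.transpose_def intro: orbit.intros)
  qed
  then show "y \<in> orbit \<rho> x - {a}" by simp
next
  have val: "?\<rho> y = (if \<rho> y = a then \<rho> a else \<rho> y)" if "y \<noteq> a" for y
    using that injD[OF assms(1), of y a] by (auto simp: Transposition.transpose_def)
  fix y assume y: "y \<in> orbit \<rho> x - {a}"
  then have "y \<in> orbit \<rho> x" by simp
  \<comment> \<open>The walk under \<open>?\<rho>\<close> jumps over \<open>a\<close>, so the
    induction records the next point \<open>\<rho> a\<close> at the moment when the original orbit
    visits \<open>a\<close>.\<close>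
  then have "(if y = a then \<rho> a else y) \<in> orbit ?\<rho> x"
  proof induction
    case base
    show ?case using orbit.base[of ?\<rho> x] by (simp only: val[OF assms(2)])
  next
    case (step y)
    show ?case
    proof (cases "y = a")
      case True
      then have "(if \<rho> y = a then \<rho> a else \<rho> y) = \<rho> a" by simp
      then show ?thesis using step.IH True by metis
    next
      case False
      then have "?\<rho> y \<in> orbit ?\<rho> x" using step.IH by (intro orbit.step) simp
      then show ?thesis by (simp only: val[OF False])
    qed
  qed
  with y show "y \<in> orbit ?\<rho> x" by simp
qed

lemma orbit_eq_of_mem:
  assumes "permutation \<rho>" "y \<in> orbit \<rho> x"
  shows "orbit \<rho> y = orbit \<rho> x"
  using orbit_cyclic_eq3[OF cyclic_on_orbit'[OF assms(1)] assms(2)] .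

section \<open>The symmetric group and its cycle counts\<close>

lemma permutation_of_sym_group: "\<rho> \<in> sym_group n \<Longrightarrow> permutation \<rho>"
  by (auto simp: sym_group_def permutation_permutes)

lemma finite_sym_group: "finite (sym_group n)"
  by (simp add: sym_group_def finite_permutations)

lemma card_sym_group: "card (sym_group n) = fact n"
  by (simp add: sym_group_def card_permutations)

lemma comp_in_sym_group: "p \<in> sym_group n \<Longrightarrow> q \<in> sym_group n \<Longrightarrow> p \<circ> q \<in> sym_group n"
  by (simp add: sym_group_def permutes_compose)

lemma inv_in_sym_group: "p \<in> sym_group n \<Longrightarrow> inv p \<in> sym_group n"
  by (simp add: sym_group_def permutes_inv)

lemma sym_group_mono: "p \<in> sym_group n \<Longrightarrow> n \<le> k \<Longrightarrow> p \<in> sym_group k"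
  by (auto simp: sym_group_def intro: permutes_subset)

lemma transpose_in_sym_group:
  "a \<in> {1..n} \<Longrightarrow> b \<in> {1..n} \<Longrightarrow> transpose a b \<in> sym_group n"
  by (simp add: sym_group_def permutes_swap_id)

lemma sym_group_apply: "p \<in> sym_group n \<Longrightarrow> p x \<in> {1..n} \<longleftrightarrow> x \<in> {1..n}"
  by (simp add: sym_group_def permutes_in_image del: atLeastAtMost_iff)

lemma sym_group_fix_last:
  assumes "p \<in> sym_group (Suc n)" "p (Suc n) = Suc n"
  shows "p \<in> sym_group n"
  unfolding sym_group_def mem_Collect_eq
  by (rule permutes_superset[of _ "{1..Suc n}"])
    (use assms in \<open>auto simp: sym_group_def le_Suc_eq\<close>)

lemma sym_group_inverses:
  assumes "p \<in> sym_group n"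
  shows "inv p \<circ> p = id" "p \<circ> inv p = id" "inv p (p x) = x" "p (inv p x) = x"
  using assms by (auto simp: sym_group_def permutes_inv_o permutes_inverses)

lemma sym_group_inj: "p \<in> sym_group n \<Longrightarrow> inj p"
  by (simp add: sym_group_def permutes_inj)

lemma bypass_in_sym_group:
  assumes "\<rho> \<in> sym_group (Suc n)"
  shows "transpose (Suc n) (\<rho> (Suc n)) \<circ> \<rho> \<in> sym_group n"
proof (rule sym_group_fix_last)
  have "\<rho> (Suc n) \<in> {1..Suc n}" using sym_group_apply[OF assms] by simp
  then show "transpose (Suc n) (\<rho> (Suc n)) \<circ> \<rho> \<in> sym_group (Suc n)"
    by (intro comp_in_sym_group transpose_in_sym_group assms) auto
qed simp

lemma cyc_inv: "\<rho> \<in> sym_group n \<Longrightarrow> cyc n (inv \<rho>) = cyc n \<rho>"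
  by (simp add: cyc_def cycles_of_def orbit_inv_eq permutation_of_sym_group cong: image_cong)

lemma finite_cycles_of: "finite (cycles_of n \<rho>)"
  by (simp add: cycles_of_def)

text \<open>Bypassing the last letter removes it from its cycle, and the cycle itself is lost only
  if that letter was a fixed point. All recursions on the number of letters rest on this.\<close>

lemma cyc_Suc:
  assumes "\<rho> \<in> sym_group (Suc n)"
  shows "cyc (Suc n) \<rho> =
    of_bool (\<rho> (Suc n) = Suc n) + cyc n (transpose (Suc n) (\<rho> (Suc n)) \<circ> \<rho>)"
proof -
  let ?N = "Suc n"
  let ?\<rho> = "transpose ?N (\<rho> ?N) \<circ> \<rho>"
  note perm = permutation_of_sym_group[OF assms]
  have set: "{1..Suc n} = insert ?N {1..n}" by auto
  have orb: "orbit ?\<rho> x = orbit \<rho> x - {?N}" if "x \<in> {1..n}" for x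
    using that by (intro orbit_transpose_comp sym_group_inj[OF assms]) auto
  have self: "x \<in> orbit \<rho> x" for x by (rule permutation_self_in_orbit[OF perm])
  show ?thesis
  proof (cases "\<rho> ?N = ?N")
    case True
    then have eq: "?\<rho> = \<rho>" by simp
    have "?N \<notin> orbit \<rho> x" if "x \<in> {1..n}" for x
      using orb[OF that] unfolding eq by blast
    then have "orbit \<rho> ?N \<notin> orbit \<rho> ` {1..n}"
      using self[of ?N] by (metis imageE)
    then show ?thesis
      unfolding eq cyc_def cycles_of_def set image_insert using True by (subst card_insert_disjoint) auto
  next
    case False
    have mem: "\<rho> ?N \<in> {1..n}"
      using False sym_group_apply[OF assms, of ?N] by auto
    have "orbit \<rho> ?N = orbit \<rho> (\<rho> ?N)"
      using permutation_orbit_step[OF perm] by simp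
    then have eq: "cycles_of ?N \<rho> = orbit \<rho> ` {1..n}"
      using imageI[OF mem, of "orbit \<rho>"] unfolding cycles_of_def set image_insert
      by (metis insert_absorb)
    have eq': "cycles_of n ?\<rho> = (\<lambda>B. B - {?N}) ` orbit \<rho> ` {1..n}"
      using orb by (force simp: cycles_of_def image_image)
    \<comment> \<open>Each of these cycles keeps an element of \<open>{1..n}\<close>, and cycles
      that share an element coincide.\<close>
    have "inj_on (\<lambda>B. B - {?N}) (orbit \<rho> ` {1..n})"
    proof (rule inj_onI)
      fix B C assume "B \<in> orbit \<rho> ` {1..n}" "C \<in> orbit \<rho> ` {1..n}" "B - {?N} = C - {?N}"
      then obtain x y where x: "x \<in> {1..n}" "B = orbit \<rho> x" "C = orbit \<rho> y" by blast
      have "x \<in> B - {?N}" using x(1) self[of x] unfolding x(2) by simp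
      then have "x \<in> orbit \<rho> y" unfolding \<open>B - {?N} = C - {?N}\<close> x(3) by simp
      then show "B = C" using x orbit_eq_of_mem[OF perm] by simp
    qed
    then have "cyc n ?\<rho> = cyc ?N \<rho>"
      unfolding cyc_def eq eq' by (rule card_image)
    then show ?thesis using False by simp
  qed
qed

lemma cyc_pos: "n \<ge> 1 \<Longrightarrow> cyc n \<rho> \<ge> 1"
  unfolding cyc_def using finite_cycles_of[of n \<rho>] by (simp add: Suc_le_eq card_gt_0_iff cycles_of_def)

text \<open>Phrased through the cycle count so that \<open>cyc_Suc\<close> applies;
  \<open>cyclic_on_iff_cyc\<close> links it to the condition in \<open>tuples\<close>.\<close>

definition full_cycles :: "nat \<Rightarrow> (nat \<Rightarrow> nat) set" where
  "full_cycles n = {c \<in> sym_group n. cyc n c = 1}"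

lemma cyclic_on_iff_cyc:
  assumes "c \<in> sym_group n" "n \<ge> 1"
  shows "cyclic_on c {1..n} \<longleftrightarrow> cyc n c = 1"
proof
  assume "cyclic_on c {1..n}"
  then have "cycles_of n c = {{1..n}}"
    using assms(2) by (auto simp: cycles_of_def cyclic_on_alldef)
  then show "cyc n c = 1" by (simp add: cyc_def)
next
  assume "cyc n c = 1"
  then obtain B where B: "cycles_of n c = {B}" by (auto simp: cyc_def card_1_singleton_iff)
  have one: "1 \<in> {1..n}" using assms(2) by simp
  have "orbit c x = orbit c 1" if "x \<in> {1..n}" for x
    using B that one unfolding cycles_of_def by (metis imageI singletonD)
  then have "{1..n} \<subseteq> orbit c 1"
    using permutation_self_in_orbit[OF permutation_of_sym_group[OF assms(1)]] by blast
  moreover have "orbit c 1 \<subseteq> {1..n}"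
    using assms one by (intro permutes_orbit_subset) (auto simp: sym_group_def)
  ultimately show "cyclic_on c {1..n}" using one by (auto simp: cyclic_on_def)
qed

text \<open>The letter \<open>Suc n\<close> is inserted into \<open>p\<close> just before
  \<open>y\<close>, or as a new fixed point if \<open>y = Suc n\<close>. Conversely,
  \<open>y\<close> is the image of \<open>Suc n\<close>, and bypassing \<open>Suc n\<close> recovers
  \<open>p\<close>.\<close>

lemma bij_betw_sym_group_Suc:
  "bij_betw (\<lambda>(y, p). transpose (Suc n) y \<circ> p) ({1..Suc n} \<times> sym_group n) (sym_group (Suc n))"
  (is "bij_betw ?f ?A ?B")
proof (rule bij_betwI[where g = "\<lambda>\<rho>. (\<rho> (Suc n), transpose (Suc n) (\<rho> (Suc n)) \<circ> \<rho>)"])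
  show "?f \<in> ?A \<rightarrow> ?B"
    by (auto intro!: comp_in_sym_group transpose_in_sym_group intro: sym_group_mono)
  show "(\<lambda>\<rho>. (\<rho> (Suc n), transpose (Suc n) (\<rho> (Suc n)) \<circ> \<rho>)) \<in> ?B \<rightarrow> ?A"
  proof
    fix \<rho> assume "\<rho> \<in> ?B"
    then show "(\<rho> (Suc n), transpose (Suc n) (\<rho> (Suc n)) \<circ> \<rho>) \<in> ?A"
      using bypass_in_sym_group[of \<rho> n] sym_group_apply[of \<rho> "Suc n" "Suc n"] by auto
  qed
next
  fix yp assume "yp \<in> ?A"
  then obtain y p where yp: "yp = (y, p)" "y \<in> {1..Suc n}" "p \<in> sym_group n" by auto
  then have "p (Suc n) = Suc n" by (auto simp: sym_group_def intro: permutes_not_in)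
  then show "(?f yp (Suc n), transpose (Suc n) (?f yp (Suc n)) \<circ> ?f yp) = yp"
    using yp by (simp add: fun_eq_iff)
qed (simp add: fun_eq_iff)

lemma transpose_comp_in_sym_group:
  assumes "y \<in> {1..Suc n}" "p \<in> sym_group n"
  shows "transpose (Suc n) y \<circ> p \<in> sym_group (Suc n)"
  using assms by (intro comp_in_sym_group transpose_in_sym_group) (auto intro: sym_group_mono)

lemma sym_group_apply_Suc: "p \<in> sym_group n \<Longrightarrow> p (Suc n) = Suc n"
  unfolding sym_group_def mem_Collect_eq by (erule permutes_not_in) simp

lemma cyc_transpose_comp:
  assumes "y \<in> {1..Suc n}" "p \<in> sym_group n"
  shows "cyc (Suc n) (transpose (Suc n) y \<circ> p) = of_bool (y = Suc n) + cyc n p"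
proof -
  have "(transpose (Suc n) y \<circ> p) (Suc n) = y"
    using sym_group_apply_Suc[OF assms(2)] by simp
  moreover have "transpose (Suc n) y \<circ> (transpose (Suc n) y \<circ> p) = p"
    by (simp add: fun_eq_iff)
  ultimately show ?thesis
    using cyc_Suc[OF transpose_comp_in_sym_group[OF assms]] by metis
qed

lemma transpose_comp_in_full_cycles_iff:
  assumes "n \<ge> 1" "y \<in> {1..Suc n}" "p \<in> sym_group n"
  shows "transpose (Suc n) y \<circ> p \<in> full_cycles (Suc n) \<longleftrightarrow> y \<noteq> Suc n \<and> p \<in> full_cycles n"
  unfolding full_cycles_def mem_Collect_eq cyc_transpose_comp[OF assms(2,3)]
  using transpose_comp_in_sym_group[OF assms(2,3)] cyc_pos[OF assms(1), of p] assms(3)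
  by (cases "y = Suc n") simp_all

text \<open>Inserting \<open>Suc n\<close> as a fixed point would create a second cycle, since
  \<open>n \<ge> 1\<close>; every other insertion keeps the number of cycles.\<close>

lemma bij_betw_full_cycles_Suc:
  assumes "n \<ge> 1"
  shows "bij_betw (\<lambda>(y, p). transpose (Suc n) y \<circ> p)
    ({1..n} \<times> full_cycles n) (full_cycles (Suc n))" (is "bij_betw ?f ?A ?B")
proof (rule bij_betw_subset[OF bij_betw_sym_group_Suc])
  have full: "c \<in> sym_group k" if "c \<in> full_cycles k" for c k
    using that by (simp add: full_cycles_def)
  show A: "?A \<subseteq> {1..Suc n} \<times> sym_group n"
    using full by fastforce
  show "?f ` ?A = ?B"
  proof (intro equalityI subsetI)
    fix q assume "q \<in> ?f ` ?A"
    then obtain x where x: "q = ?f x" "x \<in> ?A" by (rule imageE)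
    obtain y p where [simp]: "x = (y, p)" by (rule prod.exhaust)
    have q: "q = transpose (Suc n) y \<circ> p" and yp: "y \<in> {1..n}" "p \<in> full_cycles n"
      using x by simp_all
    have "y \<in> {1..Suc n}" "y \<noteq> Suc n" using yp(1) by auto
    then show "q \<in> ?B"
      unfolding q using transpose_comp_in_full_cycles_iff[OF assms] full[OF yp(2)] yp(2) by blast
  next
    fix q assume q: "q \<in> ?B"
    from full[OF q] have "q \<in> ?f ` ({1..Suc n} \<times> sym_group n)"
      using bij_betw_imp_surj_on[OF bij_betw_sym_group_Suc] by blast
    then obtain x where x: "q = ?f x" "x \<in> {1..Suc n} \<times> sym_group n" by (rule imageE)
    obtain y p where [simp]: "x = (y, p)" by (rule prod.exhaust)
    have yp: "q = transpose (Suc n) y \<circ> p" "y \<in> {1..Suc n}" "p \<in> sym_group n"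
      using x by simp_all
    have "y \<noteq> Suc n" "p \<in> full_cycles n"
      using q transpose_comp_in_full_cycles_iff[OF assms yp(2,3)] unfolding yp(1) by blast+
    moreover have "y \<in> {1..n}" using yp(2) \<open>y \<noteq> Suc n\<close> by simp
    ultimately show "q \<in> ?f ` ?A" unfolding yp(1) by (intro image_eqI[of _ _ "(y, p)"]) simp_all
  qed
qed

section \<open>Generating functions of cycle counts\<close>

lemma sum_cyc_sym_group_Suc:
  fixes f :: "nat \<Rightarrow> 'a::comm_monoid_add"
  shows "(\<Sum>\<rho>\<in>sym_group (Suc n). f (cyc (Suc n) \<rho>)) =
    (\<Sum>y\<in>{1..Suc n}. \<Sum>p\<in>sym_group n. f (of_bool (y = Suc n) + cyc n p))"
proof -
  show ?thesis
    by (subst sum.reindex_bij_betw[OF bij_betw_sym_group_Suc, symmetric])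
      (auto simp: sum.cartesian_product cyc_transpose_comp intro!: sum.cong)
qed

text \<open>Bypassing \<open>Suc n\<close> leaves a product of the same kind, whose left factor
  depends on \<open>\<alpha>\<close> and \<open>y\<close> but not on the smaller full cycle. This
  allows induction over statements about all \<open>\<alpha>\<close>.\<close>

lemma sum_cyc_full_cycles_Suc:
  fixes f :: "nat \<Rightarrow> 'a::comm_monoid_add"
  assumes "n \<ge> 1" "\<alpha> \<in> sym_group (Suc n)"
  shows "(\<Sum>c\<in>full_cycles (Suc n). f (cyc (Suc n) (\<alpha> \<circ> c))) =
    (\<Sum>y\<in>{1..n}. \<Sum>c\<in>full_cycles n. f (of_bool (\<alpha> y = Suc n) +
      cyc n (transpose (Suc n) (\<alpha> y) \<circ> (\<alpha> \<circ> transpose (Suc n) y) \<circ> c)))"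
proof -
  have *: "cyc (Suc n) (\<alpha> \<circ> (transpose (Suc n) y \<circ> c)) = of_bool (\<alpha> y = Suc n) +
      cyc n (transpose (Suc n) (\<alpha> y) \<circ> (\<alpha> \<circ> transpose (Suc n) y) \<circ> c)"
    if "y \<in> {1..n}" "c \<in> full_cycles n" for y c
  proof -
    have c: "c (Suc n) = Suc n"
      using that by (simp add: full_cycles_def sym_group_apply_Suc)
    have "\<alpha> \<circ> (transpose (Suc n) y \<circ> c) \<in> sym_group (Suc n)"
      using that assms
      by (auto simp: full_cycles_def intro!: comp_in_sym_group transpose_in_sym_group
          intro: sym_group_mono)
    from cyc_Suc[OF this] c show ?thesis by (simp add: comp_assoc)
  qed
  show ?thesis
    by (subst sum.reindex_bij_betw[OF bij_betw_full_cycles_Suc[OF assms(1)], symmetric])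
      (auto simp: sum.cartesian_product * intro!: sum.cong)
qed

lemma sym_group_0: "sym_group 0 = {id}"
  by (simp add: sym_group_def)

lemma full_cycles_1: "full_cycles 1 = {id}"
  by (auto simp: full_cycles_def sym_group_def cyc_def cycles_of_def)

lemma finite_full_cycles: "finite (full_cycles n)"
  by (simp add: full_cycles_def finite_sym_group)

lemma card_full_cycles_Suc: "card (full_cycles (Suc n)) = fact n"
proof (induction n)
  case 0
  then show ?case using full_cycles_1 by simp
next
  case (Suc n)
  then show ?case
    using bij_betw_same_card[OF bij_betw_full_cycles_Suc[of "Suc n"]]
    by (simp add: card_cartesian_product)
qed

text \<open>Of the \<open>n + 1\<close> ways to insert a letter, one creates a cycle and
  \<open>n\<close> do not; this is the factor \<open>z + of_nat n\<close>.\<close>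

lemma sum_power_cyc_sym_group:
  fixes z :: "'a::comm_semiring_1"
  shows "(\<Sum>\<rho>\<in>sym_group n. z ^ cyc n \<rho>) = pochhammer z n"
proof (induction n)
  case 0
  then show ?case by (simp add: sym_group_0 cyc_def cycles_of_def)
next
  case (Suc n)
  have "(\<Sum>\<rho>\<in>sym_group (Suc n). z ^ cyc (Suc n) \<rho>) =
      (\<Sum>y\<in>{1..Suc n}. z ^ of_bool (y = Suc n) * pochhammer z n)"
    by (simp add: sum_cyc_sym_group_Suc power_add sum_distrib_left[symmetric] Suc)
  also have "\<dots> = pochhammer z n * (z + of_nat n)"
    by (simp add: algebra_simps)
  finally show ?case by (simp add: pochhammer_Suc)
qed

lemma sum_cyc_sym_group: "(\<Sum>\<rho>\<in>sym_group n. real (cyc n \<rho>)) = fact n * harm n"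
proof (induction n)
  case 0
  then show ?case by (simp add: sym_group_0 cyc_def cycles_of_def harm_def)
next
  case (Suc n)
  have "(\<Sum>\<rho>\<in>sym_group (Suc n). real (cyc (Suc n) \<rho>)) =
      (\<Sum>y\<in>{1..Suc n}. fact n * of_bool (y = Suc n) + fact n * harm n)"
    by (simp add: sum_cyc_sym_group_Suc[where f = real] sum.distrib card_sym_group Suc)
  also have "\<dots> = fact (Suc n) * harm (Suc n)"
    by (simp add: sum.distrib harm_Suc field_simps)
  finally show ?case .
qed

lemma norm_pochhammer_le:
  fixes z :: "'a::real_normed_field"
  assumes "norm z \<le> 1"
  shows "norm (pochhammer z n) \<le> fact n"
proof (induction n)
  case (Suc n)
  have "norm (z + of_nat n) \<le> 1 + real n"
    using norm_triangle_ineq[of z "of_nat n"] assms by simp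
  then have "norm (pochhammer z n) * norm (z + of_nat n) \<le> fact n * (1 + real n)"
    using Suc by (intro mult_mono) auto
  then show ?case by (simp add: pochhammer_Suc norm_mult mult.commute)
qed simp

text \<open>
  The law of the number of cycles of \<open>\<alpha> \<circ> c\<close>, for a uniformly random full cycle \<open>c\<close>, is
  stochastically dominated by one plus a sum of independent Bernoulli variables of parameters
  \<open>1/1, \<dots>, 1/n\<close>. The right hand side below is the resulting bound on the Wasserstein
  distance, i.e. the difference of the two means, times the Lipschitz constant of \<open>k \<mapsto> z\<^sup>k\<close>.
\<close>

lemma full_cycles_generating_function_approx:
  fixes z :: complex
  assumes z: "norm z = 1" and "\<alpha> \<in> sym_group (Suc n)"
  shows "norm ((\<Sum>c\<in>full_cycles (Suc n). z ^ cyc (Suc n) (\<alpha> \<circ> c)) - z * pochhammer z n) \<le>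
    norm (z - 1) * (fact n * (1 + harm n) -
      (\<Sum>c\<in>full_cycles (Suc n). real (cyc (Suc n) (\<alpha> \<circ> c))))"
  using assms(2)
proof (induction n arbitrary: \<alpha>)
  case 0
  have "\<alpha> = id" using 0 by (simp add: sym_group_def)
  moreover have "full_cycles (Suc 0) = {id}" using full_cycles_1 by simp
  moreover have "cyc (Suc 0) (\<lambda>x. x) = 1" by (simp add: cyc_def cycles_of_def)
  ultimately show ?case by (simp add: harm_def)
next
  case (Suc n \<alpha>)
  let ?n = "Suc n" and ?N = "Suc (Suc n)"
  \<comment> \<open>\<open>b y\<close> tells whether the bypassed letter forms a cycle of its own,
    and \<open>\<beta> y\<close> is the left factor that remains. \<open>Q\<close> and
    \<open>h\<close> are \<open>fact n\<close> times the generating function and the mean of the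
    dominating variable.\<close>
  define b where "b y = (of_bool (\<alpha> y = ?N) :: nat)" for y
  define \<beta> where "\<beta> y = transpose ?N (\<alpha> y) \<circ> (\<alpha> \<circ> transpose ?N y)" for y
  define F where "F y = (\<Sum>c\<in>full_cycles ?n. z ^ cyc ?n (\<beta> y \<circ> c))" for y
  define G where "G y = (\<Sum>c\<in>full_cycles ?n. real (cyc ?n (\<beta> y \<circ> c)))" for y
  define Q where "Q = z * pochhammer z n"
  define h :: real where "h = fact n * (1 + harm n)"
  define k where "k = (\<Sum>y\<in>{1..?n}. b y)"
  have \<beta>: "\<beta> y \<in> sym_group ?n" if "y \<in> {1..?n}" for y
  proof -
    have "\<alpha> \<circ> transpose ?N y \<in> sym_group ?N"
      using that Suc.prems by (intro comp_in_sym_group transpose_in_sym_group) auto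
    from bypass_in_sym_group[OF this] show ?thesis by (simp add: \<beta>_def)
  qed
  \<comment> \<open>By injectivity at most one \<open>y\<close> is sent to \<open>?N\<close>, and
    none if \<open>\<alpha>\<close> fixes \<open>?N\<close>.\<close>
  have "k \<le> 1"
  proof -
    have "k = card {y \<in> {1..?n}. \<alpha> y = ?N}"
      unfolding k_def b_def
      by (simp add: of_bool_def sum.If_cases Int_def del: sum.cl_ivl_Suc)
    also have "\<dots> \<le> 1"
    proof -
      have "y = y'" if "\<alpha> y = ?N" "\<alpha> y' = ?N" for y y'
        using sym_group_inj[OF Suc.prems] that by (metis injD)
      then show ?thesis by (simp add: card_le_Suc0_iff_eq)
    qed
    finally show ?thesis .
  qed
  have sumF: "(\<Sum>c\<in>full_cycles ?N. z ^ cyc ?N (\<alpha> \<circ> c)) = (\<Sum>y\<in>{1..?n}. z ^ b y * F y)"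
    using Suc.prems by (subst sum_cyc_full_cycles_Suc)
      (simp_all only: F_def b_def \<beta>_def power_add sum_distrib_left)
  have sumG: "(\<Sum>c\<in>full_cycles ?N. real (cyc ?N (\<alpha> \<circ> c))) = fact n * real k + (\<Sum>y\<in>{1..?n}. G y)"
    using Suc.prems by (subst sum_cyc_full_cycles_Suc)
      (simp_all only: G_def[abs_def] b_def \<beta>_def k_def of_nat_add sum.distrib sum_constant
        card_full_cycles_Suc sum_distrib_left of_nat_sum of_nat_fact)
  have sumz: "(\<Sum>y\<in>{1..?n}. z ^ b y) = of_nat ?n + of_nat k * (z - 1)"
  proof -
    have "z ^ b y = 1 + of_nat (b y) * (z - 1)" for y by (simp add: b_def)
    then show ?thesis by (simp add: sum.distrib k_def sum_distrib_right del: sum.cl_ivl_Suc)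
  qed
  have Q: "norm Q \<le> fact n"
    using norm_pochhammer_le[of z n] z by (simp add: Q_def norm_mult)
  \<comment> \<open>Replacing each \<open>F y\<close> by \<open>Q\<close> gives \<open>Q\<close> the
    weight \<open>n + 1 + k * (z - 1)\<close>, whereas the target has
    \<open>n + 1 + (z - 1)\<close>. The mismatch carries the factor \<open>1 - k\<close>, which is
    nonnegative.\<close>
  have "(\<Sum>y\<in>{1..?n}. z ^ b y * F y) - z * pochhammer z ?n =
      (\<Sum>y\<in>{1..?n}. z ^ b y * (F y - Q)) + (\<Sum>y\<in>{1..?n}. z ^ b y) * Q - Q * (z + of_nat n)"
    by (simp add: algebra_simps sum_subtractf sum_distrib_left Q_def pochhammer_Suc
        del: sum.cl_ivl_Suc)
  also have "\<dots> = (\<Sum>y\<in>{1..?n}. z ^ b y * (F y - Q)) - of_real (1 - real k) * (z - 1) * Q"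
    unfolding sumz by (simp add: algebra_simps)
  also have "norm \<dots> \<le> (\<Sum>y\<in>{1..?n}. norm (F y - Q)) + (1 - real k) * norm (z - 1) * fact n"
  proof (rule order.trans[OF norm_triangle_ineq4 add_mono])
    show "norm (\<Sum>y\<in>{1..?n}. z ^ b y * (F y - Q)) \<le> (\<Sum>y\<in>{1..?n}. norm (F y - Q))"
      by (rule order.trans[OF norm_sum]) (simp add: norm_mult norm_power z del: sum.cl_ivl_Suc)
    show "norm (of_real (1 - real k) * (z - 1) * Q) \<le> (1 - real k) * norm (z - 1) * fact n"
      using \<open>k \<le> 1\<close> Q unfolding norm_mult norm_of_real by (intro mult_mono) auto
  qed
  also have "(\<Sum>y\<in>{1..?n}. norm (F y - Q)) \<le> (\<Sum>y\<in>{1..?n}. norm (z - 1) * (h - G y))"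
    unfolding F_def Q_def h_def G_def by (intro sum_mono Suc.IH \<beta>)
  also have "\<dots> + (1 - real k) * norm (z - 1) * fact n =
      norm (z - 1) * (real ?n * h + fact n - (fact n * real k + (\<Sum>y\<in>{1..?n}. G y)))"
    unfolding sum_distrib_left[symmetric] sum_subtractf
    by (simp add: algebra_simps del: sum.cl_ivl_Suc)
  \<comment> \<open>The mean deficits of the smaller cases and the term from \<open>1 - k\<close>
    add up exactly to the mean deficit for \<open>\<alpha>\<close>, so the constant
    \<open>norm (z - 1)\<close> does not grow.\<close>
  also have "real ?n * h + fact n = fact ?n * (1 + harm ?n)"
    by (simp add: h_def harm_Suc field_simps)
  finally show ?case unfolding sumF sumG by simp
qed

section \<open>Tuples of permutations with trivial product\<close>

lemma sym_group_comp_eq_id_iff: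
  assumes "p \<in> sym_group n" "q \<in> sym_group n"
  shows "p \<circ> q = id \<longleftrightarrow> q = inv p"
  using sym_group_inverses[OF assms(1)] by (metis comp_assoc id_comp comp_id)

text \<open>This lets a trivial product be rotated cyclically.\<close>

lemma sym_group_comp_eq_id_commute:
  assumes "p \<in> sym_group n" "q \<in> sym_group n" "p \<circ> q = id"
  shows "q \<circ> p = id"
  using assms sym_group_comp_eq_id_iff[OF assms(1,2)] sym_group_inverses[OF assms(1)] by simp

section \<open>Lists of permutations and their products\<close>

definition perm_lists :: "nat \<Rightarrow> nat \<Rightarrow> (nat \<Rightarrow> nat) list set" where
  "perm_lists n k = {l. set l \<subseteq> sym_group n \<and> length l = k}"

abbreviation perm_prod :: "(nat \<Rightarrow> nat) list \<Rightarrow> nat \<Rightarrow> nat" where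
  "perm_prod l \<equiv> foldr (\<circ>) l id"

lemma finite_perm_lists: "finite (perm_lists n k)"
  unfolding perm_lists_def by (intro finite_lists_length_eq finite_sym_group)

lemma card_perm_lists: "card (perm_lists n k) = fact n ^ k"
  unfolding perm_lists_def by (simp add: card_lists_length_eq finite_sym_group card_sym_group)

lemma sum_perm_lists_Suc:
  "(\<Sum>l\<in>perm_lists n (Suc k). f l) = (\<Sum>a\<in>sym_group n. \<Sum>l\<in>perm_lists n k. f (a # l))"
proof -
  have "bij_betw (\<lambda>(a, l). a # l) (sym_group n \<times> perm_lists n k) (perm_lists n (Suc k))"
    by (rule bij_betwI[where g = "\<lambda>l. (hd l, tl l)"])
      (auto simp: perm_lists_def length_Suc_conv)
  from sum.reindex_bij_betw[OF this, of f] show ?thesis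
    by (simp add: sum.cartesian_product case_prod_beta)
qed

lemma perm_prod_in_sym_group: "l \<in> perm_lists n k \<Longrightarrow> perm_prod l \<in> sym_group n"
proof (induction l arbitrary: k)
  case Nil
  show ?case using permutes_id[of "{1..n}"] by (simp add: sym_group_def id_def)
next
  case (Cons a l)
  then have "a \<in> sym_group n" "l \<in> perm_lists n (length l)" by (auto simp: perm_lists_def)
  with Cons.IH have "a \<circ> perm_prod l \<in> sym_group n" by (intro comp_in_sym_group)
  moreover have "perm_prod (a # l) = a \<circ> perm_prod l" by simp
  ultimately show ?case by (simp only:)
qed

lemma sum_sym_group_comp_right:
  assumes "q \<in> sym_group n"
  shows "(\<Sum>p\<in>sym_group n. f (p \<circ> q)) = (\<Sum>p\<in>sym_group n. f p)"
proof -
  have "bij_betw (\<lambda>p. p \<circ> q) (sym_group n) (sym_group n)"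
    by (rule bij_betwI[where g = "\<lambda>p. p \<circ> inv q"])
      (use assms in \<open>auto simp: comp_assoc sym_group_inverses intro: comp_in_sym_group inv_in_sym_group\<close>)
  from sum.reindex_bij_betw[OF this, of f] show ?thesis .
qed

text \<open>A single uniform entry at the front already makes the whole product uniform, whatever
  the other \<open>k\<close> entries are.\<close>

lemma sum_perm_lists_prod:
  fixes f :: "(nat \<Rightarrow> nat) \<Rightarrow> real"
  assumes "q \<in> sym_group n"
  shows "(\<Sum>l\<in>perm_lists n (Suc k). f (perm_prod l \<circ> q)) = fact n ^ k * (\<Sum>p\<in>sym_group n. f p)"
proof -
  have "(\<Sum>p\<in>sym_group n. f (p \<circ> (perm_prod l \<circ> q))) = (\<Sum>p\<in>sym_group n. f p)"
    if "l \<in> perm_lists n k" for l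
    by (intro sum_sym_group_comp_right comp_in_sym_group perm_prod_in_sym_group[OF that] assms)
  then have "(\<Sum>l\<in>perm_lists n k. \<Sum>p\<in>sym_group n. f (p \<circ> (perm_prod l \<circ> q))) =
      fact n ^ k * (\<Sum>p\<in>sym_group n. f p)"
    by (simp add: card_perm_lists)
  then show ?thesis
    by (subst (asm) sum.swap) (simp add: sum_perm_lists_Suc comp_assoc)
qed

text \<open>The entries vary independently, so their generating functions multiply.\<close>

lemma sum_perm_lists_power_cyc:
  fixes z :: "'a::comm_semiring_1"
  shows "(\<Sum>l\<in>perm_lists n k. z ^ sum_list (map (cyc n) l)) = pochhammer z n ^ k"
proof (induction k)
  case 0
  have "perm_lists n 0 = {[]}" by (auto simp: perm_lists_def)
  then show ?case by simp
next
  case (Suc k)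
  then show ?case
    by (simp add: sum_perm_lists_Suc power_add sum_distrib_left[symmetric]
        sum_distrib_right[symmetric] sum_power_cyc_sym_group)
qed

text \<open>
  The entry \<open>\<sigma>\<^sub>1\<close> is determined by the others, and \<open>\<phi>, \<sigma>\<^sub>0, \<sigma>\<^sub>2, \<dots>\<close> are free.
\<close>

definition tuple_of where
  "tuple_of = (\<lambda>(\<phi>, c, l). (\<phi>, c # inv (perm_prod l \<circ> \<phi> \<circ> c) # l))"

lemma bij_betw_tuple_of:
  assumes "n \<ge> 1"
  shows "bij_betw tuple_of (conj_class n lam \<times> full_cycles n \<times> perm_lists n k)
    (tuples (k + 2) n lam)" (is "bij_betw _ ?A ?B")
proof (rule bij_betwI[where g = "\<lambda>(\<phi>, s). (\<phi>, s ! 0, tl (tl s))"])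
  \<comment> \<open>Rotating the trivial product moves \<open>d\<close> to the end, where it can be
    solved for.\<close>
  have key: "\<phi> \<circ> (c \<circ> (d \<circ> P)) = id \<longleftrightarrow> d = inv (P \<circ> \<phi> \<circ> c)"
    if "\<phi> \<in> sym_group n" "c \<in> sym_group n" "d \<in> sym_group n" "P \<in> sym_group n" for \<phi> c d P
  proof -
    have mem: "\<phi> \<circ> c \<circ> d \<in> sym_group n" "P \<circ> \<phi> \<circ> c \<in> sym_group n"
      using that by (meson comp_in_sym_group)+
    have "\<phi> \<circ> (c \<circ> (d \<circ> P)) = id \<longleftrightarrow> (\<phi> \<circ> c \<circ> d) \<circ> P = id" by (simp only: comp_assoc)
    also have "\<dots> \<longleftrightarrow> P \<circ> (\<phi> \<circ> c \<circ> d) = id"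
      using sym_group_comp_eq_id_commute[OF mem(1) that(4)]
        sym_group_comp_eq_id_commute[OF that(4) mem(1)] by blast
    also have "\<dots> \<longleftrightarrow> (P \<circ> \<phi> \<circ> c) \<circ> d = id" by (simp only: comp_assoc)
    also have "\<dots> \<longleftrightarrow> d = inv (P \<circ> \<phi> \<circ> c)"
      by (rule sym_group_comp_eq_id_iff[OF mem(2) that(3)])
    finally show ?thesis .
  qed
  have full: "c \<in> full_cycles n \<longleftrightarrow> c \<in> sym_group n \<and> cyclic_on c {1..n}" for c
    unfolding full_cycles_def using cyclic_on_iff_cyc[OF _ assms] by blast
  have prod: "perm_prod (c # d # l) = c \<circ> (d \<circ> perm_prod l)" for c d :: "nat \<Rightarrow> nat" and l
    by simp
  show "tuple_of \<in> ?A \<rightarrow> ?B"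
  proof
    fix x assume "x \<in> ?A"
    then obtain \<phi> c l where x: "x = (\<phi>, c, l)" "\<phi> \<in> conj_class n lam" "c \<in> full_cycles n"
      "l \<in> perm_lists n k" by blast
    have c: "c \<in> sym_group n" "cyclic_on c {1..n}" using x(3) full by blast+
    have \<phi>: "\<phi> \<in> sym_group n" using x(2) by (simp add: conj_class_def)
    have P: "perm_prod l \<in> sym_group n" using x(4) by (rule perm_prod_in_sym_group)
    define d where "d = inv (perm_prod l \<circ> \<phi> \<circ> c)"
    have d: "d \<in> sym_group n"
      unfolding d_def by (intro inv_in_sym_group comp_in_sym_group P \<phi> c)
    have "\<phi> \<circ> perm_prod (c # d # l) = id"
      unfolding prod key[OF \<phi> c(1) d P] by (rule d_def)
    moreover have "tuple_of x = (\<phi>, c # d # l)" by (simp only: tuple_of_def x(1) d_def prod.case)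
    ultimately show "tuple_of x \<in> ?B"
      unfolding tuples_def using x(2,4) c d by (simp add: perm_lists_def del: foldr.simps)
  qed
  have B: "\<exists>\<phi> c d l. x = (\<phi>, c # d # l) \<and> \<phi> \<in> conj_class n lam \<and> c \<in> full_cycles n \<and>
      l \<in> perm_lists n k \<and> d = inv (perm_prod l \<circ> \<phi> \<circ> c)" if x: "x \<in> ?B" for x
  proof -
    obtain \<phi> s where x': "x = (\<phi>, s)" by (rule prod.exhaust)
    have s: "length s = k + 2" "set s \<subseteq> sym_group n" "\<phi> \<in> conj_class n lam"
      "cyclic_on (s ! 0) {1..n}" "\<phi> \<circ> perm_prod s = id"
      using x unfolding x' tuples_def by blast+
    obtain c d l where s': "s = c # d # l"
      using s(1) by (metis Suc_length_conv add_2_eq_Suc')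
    have mem: "\<phi> \<in> sym_group n" "c \<in> sym_group n" "d \<in> sym_group n"
      using s(2,3) by (simp_all add: s' conj_class_def)
    have l: "l \<in> perm_lists n k" using s(1,2) by (simp add: s' perm_lists_def)
    have "d = inv (perm_prod l \<circ> \<phi> \<circ> c)"
      using s(5) unfolding s' prod key[OF mem perm_prod_in_sym_group[OF l]] .
    moreover have "c \<in> full_cycles n" using s(4) mem(2) by (simp add: full s')
    ultimately show ?thesis using s(3) l x' s' by blast
  qed
  show "(\<lambda>(\<phi>, s). (\<phi>, s ! 0, tl (tl s))) \<in> ?B \<rightarrow> ?A"
  proof
    fix x assume "x \<in> ?B"
    from B[OF this] show "(\<lambda>(\<phi>, s). (\<phi>, s ! 0, tl (tl s))) x \<in> ?A" by (elim exE conjE) simp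
  qed
  show "tuple_of ((\<lambda>(\<phi>, s). (\<phi>, s ! 0, tl (tl s))) x) = x" if "x \<in> ?B" for x
    using B[OF that] by (elim exE conjE) (simp add: tuple_of_def)
qed (simp add: tuple_of_def case_prod_beta)

section \<open>Generating function of the total cycle count\<close>

definition total_cyc :: "nat \<Rightarrow> (nat \<Rightarrow> nat) \<times> (nat \<Rightarrow> nat) list \<Rightarrow> nat" where
  "total_cyc n M = sum_list (map (cyc n) (snd M))"

text \<open>\<open>Suc\<close> accounts for the single cycle of \<open>c\<close>; the solved entry
  is an inverse, and inversion preserves the cycle count.\<close>

lemma total_cyc_tuple_of:
  assumes "\<phi> \<in> sym_group n" "c \<in> full_cycles n" "l \<in> perm_lists n k"
  shows "total_cyc n (tuple_of (\<phi>, c, l)) =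
    Suc (cyc n (perm_prod l \<circ> \<phi> \<circ> c) + sum_list (map (cyc n) l))"
proof -
  have "perm_prod l \<circ> \<phi> \<circ> c \<in> sym_group n"
    using assms by (auto simp: full_cycles_def intro!: comp_in_sym_group perm_prod_in_sym_group)
  then show ?thesis using assms(2) by (simp add: total_cyc_def tuple_of_def cyc_inv full_cycles_def)
qed

lemma finite_conj_class: "finite (conj_class n lam)"
  by (simp add: conj_class_def finite_sym_group)

lemma card_tuples:
  "card (tuples (k + 2) (Suc n) lam) = card (conj_class (Suc n) lam) * fact n * fact (Suc n) ^ k"
  using bij_betw_same_card[OF bij_betw_tuple_of[of "Suc n" lam k]]
  by (simp add: card_cartesian_product card_full_cycles_Suc card_perm_lists del: fact_Suc)

lemma finite_tuples: "finite (tuples (k + 2) (Suc n) lam)"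
  using bij_betw_finite[OF bij_betw_tuple_of[of "Suc n" lam k]]
  by (simp add: finite_conj_class finite_full_cycles finite_perm_lists)

text \<open>The error for a single left factor may be large, but its average is not: as
  \<open>l\<close> varies, \<open>perm_prod l \<circ> \<phi>\<close> is uniform, which makes the
  mean deficit \<open>1 + harm n - harm (Suc n)\<close>, at most 1. In \<open>z\<^sup>2\<close>, one
  factor is the cycle of the full cycle, the other the constant 1 in the dominating
  variable.\<close>

lemma tuples_generating_function_approx:
  fixes z :: complex
  assumes z: "norm z = 1"
  shows "norm ((\<Sum>M\<in>tuples (Suc k + 2) (Suc n) lam. z ^ total_cyc (Suc n) M) -
      of_nat (card (conj_class (Suc n) lam)) * (z\<^sup>2 * pochhammer z n * pochhammer z (Suc n) ^ Suc k))
    \<le> card (tuples (Suc k + 2) (Suc n) lam) * norm (z - 1)"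
proof -
  let ?n = "Suc n" and ?C = "conj_class (Suc n) lam" and ?L = "perm_lists (Suc n) (Suc k)"
  define W where "W l = sum_list (map (cyc ?n) l)" for l
  define F where "F \<alpha> = (\<Sum>c\<in>full_cycles ?n. z ^ cyc ?n (\<alpha> \<circ> c))" for \<alpha>
  define G where "G \<alpha> = (\<Sum>c\<in>full_cycles ?n. real (cyc ?n (\<alpha> \<circ> c)))" for \<alpha>
  define Q where "Q = z * pochhammer z n"
  \<comment> \<open>For fixed \<open>c\<close>, the product \<open>\<alpha> \<circ> c\<close> runs
    through the whole symmetric group.\<close>
  have sumG: "(\<Sum>\<alpha>\<in>sym_group ?n. G \<alpha>) = fact n * (fact ?n * harm ?n)"
  proof -
    have "(\<Sum>\<alpha>\<in>sym_group ?n. G \<alpha>) = (\<Sum>c\<in>full_cycles ?n. \<Sum>\<alpha>\<in>sym_group ?n. real (cyc ?n (\<alpha> \<circ> c)))"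
      unfolding G_def by (rule sum.swap)
    also have "\<dots> = (\<Sum>c\<in>full_cycles ?n. fact ?n * harm ?n)"
      using sum_sym_group_comp_right[where f = "\<lambda>p. real (cyc ?n p)"]
      by (intro sum.cong) (simp_all add: full_cycles_def sum_cyc_sym_group)
    finally show ?thesis by (simp add: card_full_cycles_Suc)
  qed
  \<comment> \<open>The weight \<open>z ^ Suc (W l)\<close> is correlated with the product of
    \<open>l\<close>, but it has norm 1 and drops out in the triangle inequality. Only the average
    of \<open>G\<close> over a uniform product is left to compute.\<close>
  have bound: "norm (\<Sum>l\<in>?L. z ^ Suc (W l) * (F (perm_prod l \<circ> \<phi>) - Q))
      \<le> fact n * fact ?n ^ Suc k * norm (z - 1)" if "\<phi> \<in> ?C" for \<phi>
  proof -
    have \<phi>: "\<phi> \<in> sym_group ?n" using that by (simp add: conj_class_def)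
    have "norm (\<Sum>l\<in>?L. z ^ Suc (W l) * (F (perm_prod l \<circ> \<phi>) - Q))
        \<le> (\<Sum>l\<in>?L. norm (F (perm_prod l \<circ> \<phi>) - Q))"
      by (rule order.trans[OF norm_sum]) (simp add: norm_mult norm_power z)
    also have "\<dots> \<le> (\<Sum>l\<in>?L. norm (z - 1) * (fact n * (1 + harm n) - G (perm_prod l \<circ> \<phi>)))"
      unfolding F_def G_def Q_def
      by (intro sum_mono full_cycles_generating_function_approx z comp_in_sym_group
          perm_prod_in_sym_group[of _ _ "Suc k"] \<phi>)
    also have "\<dots> = norm (z - 1) * (fact ?n ^ Suc k * (fact n * (1 + harm n)) -
        fact ?n ^ k * (fact n * (fact ?n * harm ?n)))"
      unfolding sum_distrib_left[symmetric] sum_subtractf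
        sum_perm_lists_prod[OF \<phi>, of G] sumG
      by (simp add: card_perm_lists del: fact_Suc)
    also have "\<dots> = norm (z - 1) * (fact n * fact ?n ^ Suc k * (1 + harm n - harm ?n))"
      by (simp add: algebra_simps del: fact_Suc)
    also have "\<dots> \<le> norm (z - 1) * (fact n * fact ?n ^ Suc k * 1)"
      by (intro mult_left_mono) (auto simp: harm_Suc simp del: fact_Suc)
    finally show ?thesis by (simp add: mult.commute)
  qed
  have "(\<Sum>M\<in>tuples (Suc k + 2) ?n lam. z ^ total_cyc ?n M) =
      (\<Sum>x\<in>?C \<times> full_cycles ?n \<times> ?L. z ^ total_cyc ?n (tuple_of x))"
    by (rule sum.reindex_bij_betw[OF bij_betw_tuple_of, symmetric]) simp
  also have "\<dots> = (\<Sum>\<phi>\<in>?C. \<Sum>c\<in>full_cycles ?n. \<Sum>l\<in>?L. z ^ Suc (W l) * z ^ cyc ?n (perm_prod l \<circ> \<phi> \<circ> c))"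
    unfolding sum.cartesian_product
    by (intro sum.cong refl)
      (auto simp: conj_class_def total_cyc_tuple_of W_def power_add)
  also have "\<dots> = (\<Sum>\<phi>\<in>?C. \<Sum>l\<in>?L. z ^ Suc (W l) * F (perm_prod l \<circ> \<phi>))"
    unfolding F_def sum_distrib_left by (intro sum.cong refl sum.swap)
  finally have eq: "(\<Sum>M\<in>tuples (Suc k + 2) ?n lam. z ^ total_cyc ?n M) =
      (\<Sum>\<phi>\<in>?C. \<Sum>l\<in>?L. z ^ Suc (W l) * F (perm_prod l \<circ> \<phi>))" .
  have "(\<Sum>l\<in>?L. z ^ Suc (W l) * Q) = z\<^sup>2 * pochhammer z n * pochhammer z ?n ^ Suc k"
    unfolding W_def power_Suc sum_distrib_left[symmetric] sum_distrib_right[symmetric]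
      sum_perm_lists_power_cyc by (simp add: Q_def power2_eq_square)
  then have eq': "of_nat (card ?C) * (z\<^sup>2 * pochhammer z n * pochhammer z ?n ^ Suc k) =
      (\<Sum>\<phi>\<in>?C. \<Sum>l\<in>?L. z ^ Suc (W l) * Q)" by simp
  have "norm ((\<Sum>M\<in>tuples (Suc k + 2) ?n lam. z ^ total_cyc ?n M) -
      of_nat (card ?C) * (z\<^sup>2 * pochhammer z n * pochhammer z ?n ^ Suc k)) =
    norm (\<Sum>\<phi>\<in>?C. \<Sum>l\<in>?L. z ^ Suc (W l) * (F (perm_prod l \<circ> \<phi>) - Q))"
    unfolding eq eq' by (simp only: sum_subtractf right_diff_distrib)
  also have "\<dots> \<le> (\<Sum>\<phi>\<in>?C. fact n * fact ?n ^ Suc k * norm (z - 1))"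
    by (rule order.trans[OF norm_sum sum_mono[OF bound]])
  also have "\<dots> = card (tuples (Suc k + 2) ?n lam) * norm (z - 1)"
    unfolding card_tuples by (simp del: fact_Suc)
  finally show ?thesis .
qed

section \<open>Existence of permutations of a given cycle type\<close>

lemma ex_cyclic_permutes_interval:
  assumes "k \<ge> 1"
  shows "\<exists>q. q permutes {Suc n..n + k} \<and> cyclic_on q {Suc n..n + k}"
proof -
  let ?A = "{Suc n..n + k}"
  define q where "q x = (if x \<in> ?A then if x = n + k then Suc n else Suc x else x)" for x
  have in_A: "q x \<in> ?A" if "x \<in> ?A" for x
    using that unfolding q_def by (cases "x = n + k") simp_all
  have inj: "inj_on q ?A" by (rule inj_onI) (simp add: q_def split: if_splits)
  have "q ` ?A = ?A"
    using in_A by (intro endo_inj_surj inj image_subsetI) simp_all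
  with inj have "bij_betw q ?A ?A" by (rule bij_betw_imageI)
  then have perm: "q permutes ?A"
  proof (rule bij_imp_permutes)
    show "q x = x" if "x \<notin> ?A" for x using that by (simp only: q_def if_False)
  qed
  have pow: "(q ^^ j) (Suc n) = Suc n + j" if "j < k" for j
    using that
  proof (induction j)
    case (Suc j)
    then have "(q ^^ Suc j) (Suc n) = q (Suc n + j)" by simp
    also have "\<dots> = Suc n + Suc j" using Suc.prems by (simp add: q_def)
    finally show ?case .
  qed simp
  have "(q ^^ k) (Suc n) = Suc n"
  proof -
    obtain j where j: "k = Suc j" using assms by (cases k) auto
    then have "(q ^^ k) (Suc n) = q (Suc n + j)" using pow[of j] by simp
    then show ?thesis by (simp add: q_def j)
  qed
  then have "orbit q (Suc n) = {(q ^^ j) (Suc n) | j. j < k}"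
    by (rule orbit_altdef_bounded) (use assms in simp)
  also have "\<dots> = (\<lambda>j. (q ^^ j) (Suc n)) ` {0..<k}" by auto
  also have "\<dots> = (+) (Suc n) ` {0..<k}" using pow by (intro image_cong) simp_all
  also have "\<dots> = ?A" unfolding image_add_atLeastLessThan by auto
  finally have "orbit q (Suc n) = ?A" .
  then have "cyclic_on q ?A" using assms by (intro cyclic_on_singleI[of "Suc n"]) simp_all
  with perm show ?thesis by blast
qed

lemma conj_class_nonempty:
  assumes "is_partition lam n"
  shows "conj_class n lam \<noteq> {}"
  using assms
proof (induction lam arbitrary: n)
  case empty
  then show ?case
    by (auto simp: is_partition_def conj_class_def cycle_type_def cycles_of_def sym_group_def)
next
  case (add k lam)
  define n' where "n' = sum_mset lam"
  have part: "is_partition lam n'" and k: "k \<ge> 1" and n: "n = n' + k"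
    using add.prems by (auto simp: is_partition_def n'_def)
  let ?A = "{Suc n'..n' + k}"
  obtain p where p: "p permutes {1..n'}" "cycle_type n' p = lam"
    using add.IH[OF part] by (auto simp: conj_class_def sym_group_def)
  obtain q where q: "q permutes ?A" "cyclic_on q ?A"
    using ex_cyclic_permutes_interval[OF k] by blast
  have set: "{1..n} = {1..n'} \<union> ?A" using n by auto
  have pq: "p \<circ> q permutes {1..n}"
    unfolding set
    by (intro permutes_compose permutes_subset[OF p(1)] permutes_subset[OF q(1)]) simp_all
  have "cyclic_on (p \<circ> q) ?A"
    using p(1) q(2) by (rule permutes_comp_preserves_cyclic2[where B = "?A"]) auto
  then have A: "orbit (p \<circ> q) x = ?A" if "x \<in> ?A" for x
    using that by (rule orbit_cyclic_eq3)
  have P: "orbit (p \<circ> q) x = orbit p x" if "x \<in> {1..n'}" for x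
  proof (rule orbit_cyclic_eq3)
    show "cyclic_on (p \<circ> q) (orbit p x)"
    proof (rule permutes_comp_preserves_cyclic1[OF q(1)])
      show "cyclic_on p (orbit p x)" by (rule cyclic_on_orbit[OF p(1)]) simp
      show "orbit p x \<subseteq> {1..n'}" by (rule permutes_orbit_subset[OF p(1) that])
    qed auto
    show "x \<in> orbit p x"
      using p(1) permutation_permutes by (intro permutation_self_in_orbit) blast
  qed
  have "cycles_of n (p \<circ> q) = orbit (p \<circ> q) ` {1..n'} \<union> orbit (p \<circ> q) ` ?A"
    unfolding cycles_of_def set image_Un ..
  also have "orbit (p \<circ> q) ` {1..n'} = cycles_of n' p"
    unfolding cycles_of_def by (rule image_cong[OF refl P])
  also have "orbit (p \<circ> q) ` ?A = (\<lambda>x. ?A) ` ?A" by (rule image_cong[OF refl A])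
  also have "\<dots> = {?A}" using k by (intro image_constant[of "Suc n'"]) auto
  finally have "cycles_of n (p \<circ> q) = insert ?A (cycles_of n' p)"
    by (simp only: Un_insert_right Un_empty_right)
  \<comment> \<open>\<open>cycles_of\<close> is a set, so the new block adds a part only if it
    differs from all old cycles; it contains \<open>n\<close>, which exceeds
    \<open>n'\<close>.\<close>
  moreover have "?A \<notin> cycles_of n' p"
  proof
    assume "?A \<in> cycles_of n' p"
    then obtain x where "x \<in> {1..n'}" "?A = orbit p x" by (auto simp only: cycles_of_def)
    with permutes_orbit_subset[OF p(1) this(1)] have "?A \<subseteq> {1..n'}" by (simp only:)
    moreover have "n \<in> ?A" using k n by simp
    ultimately show False using k n by auto
  qed
  ultimately have "cycle_type n (p \<circ> q) = add_mset k lam"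
    using p(2) n by (simp add: cycle_type_def finite_cycles_of)
  with pq show ?case by (auto simp: conj_class_def sym_group_def)
qed

section \<open>Asymptotics of the characteristic functions\<close>

text \<open>Each factor is the generating function of a Bernoulli variable of parameter
  \<open>1 / j\<close>.\<close>

lemma pochhammer_div_fact_eq_prod:
  "pochhammer z n / fact n = (\<Prod>j\<in>{1..n}. 1 + (z - 1) / of_nat j)" for z :: complex
proof (induction n)
  case (Suc n)
  have "pochhammer z (Suc n) / fact (Suc n) = pochhammer z n / fact n * ((z + of_nat n) / of_nat (Suc n))"
    by (simp add: pochhammer_Suc)
  also have "(z + of_nat n) / of_nat (Suc n) = 1 + (z - 1) / of_nat (Suc n)"
    by (simp add: field_simps del: of_nat_Suc) simp
  finally show ?case by (simp add: Suc)
qed simp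

text \<open>This is the Taylor remainder of order two; the constant 3 bounds
  \<open>exp 1\<close>.\<close>

lemma norm_exp_diff_le:
  fixes w :: complex
  assumes "norm w \<le> 1"
  shows "norm (1 + w - exp w) \<le> 3 * (norm w)\<^sup>2"
proof -
  have "\<bar>Re w\<bar> \<le> 1" using abs_Re_le_cmod[of w] assms by simp
  then have "exp \<bar>Re w\<bar> \<le> 3" using exp_le by (metis exp_le_cancel_iff order.trans)
  have "norm (exp w - (1 + w)) \<le> exp \<bar>Re w\<bar> * (norm w)\<^sup>2"
    using Taylor_exp[of w 1] by (simp add: power2_eq_square)
  also have "\<dots> \<le> 3 * (norm w)\<^sup>2" using \<open>exp \<bar>Re w\<bar> \<le> 3\<close> by (intro mult_right_mono) auto
  finally show ?thesis by (simp add: norm_minus_commute)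
qed

text \<open>A Poisson approximation: the exponential is the generating function of a Poisson
  variable of mean \<open>harm n\<close>. All factors have norm at most 1, so the difference of the
  products is bounded by the sum of the differences, of order \<open>1 / j\<^sup>2\<close>.\<close>

lemma norm_pochhammer_div_fact_sub_exp_le:
  fixes z :: complex
  assumes "norm z \<le> 1" "norm (z - 1) \<le> 1"
  shows "norm (pochhammer z n / fact n - exp ((z - 1) * of_real (harm n))) \<le>
    3 * (norm (z - 1))\<^sup>2 * (\<Sum>j. inverse (real j ^ 2))"
proof -
  have "exp ((z - 1) * of_real (harm n)) = (\<Prod>j\<in>{1..n}. exp ((z - 1) / of_nat j))"
    by (simp add: harm_def sum_distrib_left exp_sum[symmetric] field_simps)
  then have "norm (pochhammer z n / fact n - exp ((z - 1) * of_real (harm n))) =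
      norm ((\<Prod>j\<in>{1..n}. 1 + (z - 1) / of_nat j) - (\<Prod>j\<in>{1..n}. exp ((z - 1) / of_nat j)))"
    by (simp only: pochhammer_div_fact_eq_prod)
  also have "\<dots> \<le> (\<Sum>j\<in>{1..n}. norm (1 + (z - 1) / of_nat j - exp ((z - 1) / of_nat j)))"
  proof (rule norm_prod_diff)
    fix j assume j: "j \<in> {1..n}"
    have "1 + (z - 1) / of_nat j = (of_nat (j - 1) + z) / of_nat j"
      using j by (simp add: field_simps of_nat_diff)
    moreover have "norm (of_nat (j - 1) + z) \<le> real j"
      using norm_triangle_ineq[of "of_nat (j - 1)" z] assms(1) j by (simp add: of_nat_diff)
    ultimately show "norm (1 + (z - 1) / of_nat j) \<le> 1"
      using j by (simp add: norm_divide)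
    have "Re z \<le> 1" using complex_Re_le_cmod[of z] assms(1) by simp
    then show "norm (exp ((z - 1) / of_nat j)) \<le> 1"
      by (simp add: Re_divide_of_nat divide_nonpos_nonneg)
  qed
  also have "\<dots> \<le> (\<Sum>j\<in>{1..n}. 3 * (norm (z - 1))\<^sup>2 * inverse (real j ^ 2))"
  proof (rule sum_mono)
    fix j assume j: "j \<in> {1..n}"
    have "norm ((z - 1) / of_nat j) \<le> norm (z - 1)"
      using j mult_left_mono[of 1 "real j" "norm (z - 1)"] by (simp add: norm_divide divide_le_eq)
    then have "norm (1 + (z - 1) / of_nat j - exp ((z - 1) / of_nat j)) \<le>
        3 * (norm ((z - 1) / of_nat j))\<^sup>2"
      using assms(2) by (intro norm_exp_diff_le) auto
    then show "norm (1 + (z - 1) / of_nat j - exp ((z - 1) / of_nat j)) \<le>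
        3 * (norm (z - 1))\<^sup>2 * inverse (real j ^ 2)"
      by (simp add: norm_divide power_divide) (simp add: divide_inverse mult.assoc)
  qed
  \<comment> \<open>The series starts at \<open>j = 0\<close>, where the term is 0 because
    \<open>inverse 0 = 0\<close>.\<close>
  also have "\<dots> \<le> 3 * (norm (z - 1))\<^sup>2 * (\<Sum>j. inverse (real j ^ 2))"
    unfolding sum_distrib_left[symmetric]
    by (intro mult_left_mono sum_le_suminf inverse_power_summable) auto
  finally show ?thesis .
qed

lemma norm_iexp_sub_1_le: "norm (iexp x - 1) \<le> \<bar>x\<bar>"
  using iexp_approx1[of x 0] by simp

lemma ln_real_at_top: "filterlim (\<lambda>n. ln (real n)) at_top sequentially"
  by (rule filterlim_compose[OF ln_at_top filterlim_real_sequentially])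

section \<open>Limits under the scaling by \<open>sqrt (ln n)\<close>\<close>

context
  fixes a :: real and \<theta> :: "nat \<Rightarrow> real"
  assumes \<theta>: "\<And>n. \<theta> n = a / sqrt (ln (real n))"
begin

lemma theta_tendsto_0: "\<theta> \<longlonglongrightarrow> 0"
proof -
  have "filterlim (\<lambda>n. sqrt (ln (real n))) at_infinity sequentially"
    by (intro filterlim_at_top_imp_at_infinity filterlim_compose[OF sqrt_at_top ln_real_at_top])
  then have "(\<lambda>n. a / sqrt (ln (real n))) \<longlonglongrightarrow> 0"
    by (rule tendsto_divide_0[OF tendsto_const])
  then show ?thesis by (simp add: \<theta>[abs_def])
qed

text \<open>\<open>harm n - ln n\<close> converges, and \<open>(\<theta> n)\<^sup>2 * ln n\<close>
  equals \<open>a\<^sup>2\<close> once \<open>n \<ge> 2\<close> makes the logarithm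
  positive.\<close>

lemma theta_sq_harm_tendsto: "(\<lambda>n. (\<theta> n)\<^sup>2 * harm n) \<longlonglongrightarrow> a\<^sup>2"
proof (rule Lim_transform_eventually)
  have "(\<lambda>n. a\<^sup>2 + (\<theta> n)\<^sup>2 * (harm n - ln (real n))) \<longlonglongrightarrow> a\<^sup>2 + 0\<^sup>2 * euler_mascheroni"
    by (intro tendsto_intros theta_tendsto_0 euler_mascheroni_LIMSEQ)
  then show "(\<lambda>n. a\<^sup>2 + (\<theta> n)\<^sup>2 * (harm n - ln (real n))) \<longlonglongrightarrow> a\<^sup>2" by simp
  show "eventually (\<lambda>n. a\<^sup>2 + (\<theta> n)\<^sup>2 * (harm n - ln (real n)) = (\<theta> n)\<^sup>2 * harm n) sequentially"
    using eventually_ge_at_top[of 2]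
  proof eventually_elim
    case (elim n)
    then have "(\<theta> n)\<^sup>2 * ln (real n) = a\<^sup>2" by (simp add: \<theta> power_divide)
    then show ?case by (simp add: algebra_simps)
  qed
qed

text \<open>The Poisson approximation costs only a multiple of \<open>(\<theta> n)\<^sup>2\<close>,
  and the centred Poisson exponent is expanded to second order in \<open>\<theta> n\<close>.\<close>

lemma pochhammer_iexp_tendsto:
  "(\<lambda>n. iexp (- (\<theta> n * ln (real n))) * (pochhammer (iexp (\<theta> n)) n / fact n))
    \<longlonglongrightarrow> of_real (exp (- (a\<^sup>2) / 2))"
proof -
  \<comment> \<open>\<open>R n\<close> is the remainder after the quadratic Taylor term; being cubic
    in \<open>\<theta> n\<close>, it vanishes even when multiplied by \<open>harm n\<close>.\<close>
  define R where "R n = iexp (\<theta> n) - 1 - \<i> * \<theta> n + (\<theta> n)\<^sup>2 / 2" for n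
  have R: "norm (R n) \<le> \<bar>\<theta> n\<bar> * (\<theta> n)\<^sup>2" for n
  proof -
    have "R n = iexp (\<theta> n) - (\<Sum>k\<le>2. (\<i> * \<theta> n)^k / fact k)"
      by (simp add: R_def numeral_2_eq_2 power_mult_distrib field_simps)
    then have "norm (R n) \<le> \<bar>\<theta> n\<bar> ^ 3 / fact 3"
      using iexp_approx1[of "\<theta> n" 2] by (simp add: eval_nat_numeral)
    also have "\<dots> \<le> \<bar>\<theta> n\<bar> ^ 3" by (simp add: fact_numeral)
    finally show ?thesis by (simp add: power3_eq_cube power2_eq_square abs_mult mult.assoc)
  qed
  have RH: "(\<lambda>n. R n * harm n) \<longlonglongrightarrow> 0"
  proof (rule Lim_null_comparison)
    show "eventually (\<lambda>n. norm (R n * harm n) \<le> \<bar>\<theta> n\<bar> * ((\<theta> n)\<^sup>2 * harm n)) sequentially"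
      using mult_right_mono[OF R, of "harm n" for n]
      by (intro always_eventually) (auto simp: norm_mult norm_harm harm_nonneg mult.assoc)
    show "(\<lambda>n. \<bar>\<theta> n\<bar> * ((\<theta> n)\<^sup>2 * harm n)) \<longlonglongrightarrow> 0"
      using tendsto_mult[OF tendsto_rabs[OF theta_tendsto_0] theta_sq_harm_tendsto] by simp
  qed
  \<comment> \<open>The exponent consists of the Taylor remainder, the variance term and the error
    of centring at \<open>ln n\<close> instead of \<open>harm n\<close>. Only the variance term
    survives.\<close>
  have "(\<lambda>n. R n * harm n - of_real ((\<theta> n)\<^sup>2 * harm n / 2) + \<i> * of_real (\<theta> n * (harm n - ln (real n))))
      \<longlonglongrightarrow> 0 - of_real (a\<^sup>2 / 2) + \<i> * of_real (0 * euler_mascheroni)"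
    by (intro tendsto_intros RH theta_tendsto_0 theta_sq_harm_tendsto euler_mascheroni_LIMSEQ) simp
  then have "(\<lambda>n. exp (R n * harm n - of_real ((\<theta> n)\<^sup>2 * harm n / 2) +
      \<i> * of_real (\<theta> n * (harm n - ln (real n))))) \<longlonglongrightarrow> exp (- of_real (a\<^sup>2 / 2))"
    by (intro tendsto_exp) simp
  moreover have "exp (R n * harm n - of_real ((\<theta> n)\<^sup>2 * harm n / 2) +
      \<i> * of_real (\<theta> n * (harm n - ln (real n)))) =
      iexp (- (\<theta> n * ln (real n))) * exp ((iexp (\<theta> n) - 1) * of_real (harm n))" for n
    unfolding exp_add[symmetric] R_def
    by (rule arg_cong[where f = exp]) (simp add: algebra_simps of_real_harm)
  ultimately have main: "(\<lambda>n. iexp (- (\<theta> n * ln (real n))) * exp ((iexp (\<theta> n) - 1) * of_real (harm n)))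
      \<longlonglongrightarrow> of_real (exp (- (a\<^sup>2) / 2))"
    by (simp add: exp_of_real[symmetric] del: exp_of_real)
  define S :: real where "S = (\<Sum>j. inverse (real j ^ 2))"
  have "S \<ge> 0" unfolding S_def by (intro suminf_nonneg inverse_power_summable) auto
  have "(\<lambda>n. iexp (- (\<theta> n * ln (real n))) * (pochhammer (iexp (\<theta> n)) n / fact n) -
      iexp (- (\<theta> n * ln (real n))) * exp ((iexp (\<theta> n) - 1) * of_real (harm n))) \<longlonglongrightarrow> 0"
  proof (rule Lim_null_comparison)
    have "eventually (\<lambda>n. \<bar>\<theta> n\<bar> < 1) sequentially"
      using tendsto_rabs[OF theta_tendsto_0] by (rule order_tendstoD) simp
    then show "eventually (\<lambda>n. norm (iexp (- (\<theta> n * ln (real n))) * (pochhammer (iexp (\<theta> n)) n / fact n) -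
      iexp (- (\<theta> n * ln (real n))) * exp ((iexp (\<theta> n) - 1) * of_real (harm n))) \<le> 3 * \<bar>\<theta> n\<bar>\<^sup>2 * S) sequentially"
    proof eventually_elim
      case (elim n)
      have "norm (iexp (- (\<theta> n * ln (real n))) * (pochhammer (iexp (\<theta> n)) n / fact n) -
          iexp (- (\<theta> n * ln (real n))) * exp ((iexp (\<theta> n) - 1) * of_real (harm n))) =
          norm (pochhammer (iexp (\<theta> n)) n / fact n - exp ((iexp (\<theta> n) - 1) * of_real (harm n)))"
        unfolding right_diff_distrib[symmetric] norm_mult norm_exp_i_times by simp
      also have "\<dots> \<le> 3 * (norm (iexp (\<theta> n) - 1))\<^sup>2 * S"
        unfolding S_def using elim norm_iexp_sub_1_le[of "\<theta> n"]
        by (intro norm_pochhammer_div_fact_sub_exp_le) auto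
      also have "\<dots> \<le> 3 * \<bar>\<theta> n\<bar>\<^sup>2 * S"
        using \<open>S \<ge> 0\<close> norm_iexp_sub_1_le[of "\<theta> n"]
        by (intro mult_right_mono mult_left_mono power_mono) auto
      finally show ?case .
    qed
    have "(\<lambda>n. 3 * \<bar>\<theta> n\<bar>\<^sup>2 * S) \<longlonglongrightarrow> 3 * \<bar>0\<bar>\<^sup>2 * S"
      by (intro tendsto_intros theta_tendsto_0)
    then show "(\<lambda>n. 3 * \<bar>\<theta> n\<bar>\<^sup>2 * S) \<longlonglongrightarrow> 0" by simp
  qed
  from tendsto_add[OF this main] show ?thesis by simp
qed

text \<open>The factor \<open>1 + (z - 1) / n\<close> by which the two products differ is negligible.\<close>

lemma pochhammer_iexp_tendsto':
  "(\<lambda>n. iexp (- (\<theta> n * ln (real n))) * (pochhammer (iexp (\<theta> n)) (n - 1) / fact (n - 1)))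
    \<longlonglongrightarrow> of_real (exp (- (a\<^sup>2) / 2))"
proof -
  have "(\<lambda>n. iexp (- (\<theta> n * ln (real n))) * (pochhammer (iexp (\<theta> n)) n / fact n) -
      iexp (- (\<theta> n * ln (real n))) * (pochhammer (iexp (\<theta> n)) (n - 1) / fact (n - 1))) \<longlonglongrightarrow> 0"
  proof (rule Lim_null_comparison)
    show "eventually (\<lambda>n. norm (iexp (- (\<theta> n * ln (real n))) * (pochhammer (iexp (\<theta> n)) n / fact n) -
      iexp (- (\<theta> n * ln (real n))) * (pochhammer (iexp (\<theta> n)) (n - 1) / fact (n - 1))) \<le> \<bar>\<theta> n\<bar>) sequentially"
      using eventually_ge_at_top[of 1]
    proof eventually_elim
      case (elim n)
      then obtain k where n: "n = Suc k" by (cases n) auto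
      define z where "z = iexp (\<theta> n)"
      have "pochhammer z n / fact n = pochhammer z k / fact k * (1 + (z - 1) / of_nat n)"
        unfolding pochhammer_div_fact_eq_prod n by (simp add: mult.commute)
      then have "pochhammer z n / fact n - pochhammer z k / fact k =
          pochhammer z k / fact k * ((z - 1) / of_nat n)" by (simp only: distrib_left) simp
      then have "norm (iexp (- (\<theta> n * ln (real n))) * (pochhammer z n / fact n) -
          iexp (- (\<theta> n * ln (real n))) * (pochhammer z k / fact k)) =
          norm (pochhammer z k / fact k) * (norm (z - 1) / real n)"
        unfolding right_diff_distrib[symmetric] by (simp add: norm_mult norm_divide del: of_nat_Suc)
      also have "\<dots> \<le> 1 * (\<bar>\<theta> n\<bar> / 1)"
      proof (intro mult_mono frac_le)
        show "norm (pochhammer z k / fact k) \<le> 1"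
          using norm_pochhammer_le[of z k] by (simp add: norm_divide z_def)
      qed (use elim norm_iexp_sub_1_le in \<open>auto simp: z_def\<close>)
      finally show ?case by (simp add: n z_def)
    qed
    show "(\<lambda>n. \<bar>\<theta> n\<bar>) \<longlonglongrightarrow> 0" using tendsto_rabs[OF theta_tendsto_0] by simp
  qed
  from tendsto_diff[OF pochhammer_iexp_tendsto this] show ?thesis by simp
qed

end

text \<open>The genus is affine in the total cycle count, so its characteristic function is, up to a
  phase, the generating function on the unit circle. Its approximation splits into
  \<open>m - 1\<close> centred factors.\<close>

lemma char_genus_approx:
  fixes t :: real
  assumes k: "m = Suc k + 2" and part: "is_partition lam n" and n: "n \<ge> 2"
    and \<mu>: "\<mu> = ((real m - 1) * real n - real (size lam)) / 2 - (real m - 1) / 2 * ln (real n)"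
    and \<sigma>: "\<sigma> = sqrt ((real m - 1) / 4 * ln (real n))"
    and \<theta>: "\<theta> = - t / sqrt (real m - 1) / sqrt (ln (real n))"
  shows "norm (char (distr (measure_pmf (pmf_of_set (tuples m n lam))) borel
      (\<lambda>M. (genus m n lam M - \<mu>) / \<sigma>)) t -
    (iexp (- (\<theta> * ln (real n))) * (pochhammer (iexp \<theta>) (n - 1) / fact (n - 1))) *
    (iexp (- (\<theta> * ln (real n))) * (pochhammer (iexp \<theta>) n / fact n)) ^ Suc k) \<le> \<bar>\<theta>\<bar>"
proof -
  obtain n' where n': "n = Suc n'" using n by (cases n) auto
  define z where "z = iexp \<theta>"
  define L where "L = ln (real n)"
  define T where "T = tuples m n lam"
  define E where "E = iexp (- (\<theta> * (2 + (real m - 1) * L)))"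
  define c where "c = card (conj_class n lam)"
  have L: "L > 0" using n by (simp add: L_def)
  have "norm z = 1" by (simp add: z_def)
  \<comment> \<open>\<open>pmf_of_set\<close> is the uniform law only on finite nonempty sets, hence
    \<open>T\<close> must be shown to be nonempty.\<close>
  have "c > 0"
    using conj_class_nonempty[OF part] by (simp add: c_def card_gt_0_iff finite_conj_class)
  have cardT: "card T = c * fact n' * fact n ^ Suc k"
    unfolding T_def k n' c_def by (rule card_tuples)
  have finT: "finite T" unfolding T_def k n' by (rule finite_tuples)
  have "card T > 0" unfolding cardT using \<open>c > 0\<close> by simp
  then have T0: "T \<noteq> {}" by auto
  \<comment> \<open>The slope \<open>-1/2\<close> of the genus and the factor \<open>1/2\<close> in
    \<open>\<sigma>\<close> combine to the coefficient \<open>\<theta>\<close>, with the minus sign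
    of the slope.\<close>
  have pt: "iexp (t * ((genus m n lam M - \<mu>) / \<sigma>)) = E * z ^ total_cyc n M" if "M \<in> T" for M
  proof -
    obtain \<phi> s where M: "M = (\<phi>, s)" by (rule prod.exhaust)
    have [simp]: "length s = m" using that by (simp add: M T_def tuples_def)
    have "(\<Sum>i<m. real (cyc n (s ! i))) = real (total_cyc n M)"
      by (simp add: M total_cyc_def sum_list_sum_nth atLeast0LessThan)
    then have "genus m n lam M - \<mu> = - (real (total_cyc n M) - 2 - (real m - 1) * L) / 2"
      by (simp add: genus_def M \<mu> L_def field_simps)
    moreover have "\<sigma> = sqrt (real m - 1) * sqrt L / 2"
      by (simp add: \<sigma> L_def real_sqrt_mult real_sqrt_divide)
    moreover have "t * ((- Y / 2) / (r * q / 2)) = - t / r / q * Y"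
      if "r > 0" "q > 0" for r q Y :: real
      using that by (simp add: field_simps)
    ultimately have "t * ((genus m n lam M - \<mu>) / \<sigma>) =
        \<theta> * (real (total_cyc n M) - 2 - (real m - 1) * L)"
      using L k by (simp only: \<theta> L_def[symmetric] real_sqrt_gt_0_iff)
    also have "\<dots> = - (\<theta> * (2 + (real m - 1) * L)) + real (total_cyc n M) * \<theta>"
      by (simp add: algebra_simps)
    finally have *: "t * ((genus m n lam M - \<mu>) / \<sigma>) =
        - (\<theta> * (2 + (real m - 1) * L)) + real (total_cyc n M) * \<theta>" .
    show ?thesis
      unfolding * E_def z_def exp_of_nat_mult[symmetric] exp_add[symmetric]
      by (simp add: algebra_simps)
  qed
  have "char (distr (measure_pmf (pmf_of_set T)) borel (\<lambda>M. (genus m n lam M - \<mu>) / \<sigma>)) t =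
      (\<Sum>M\<in>T. iexp (t * ((genus m n lam M - \<mu>) / \<sigma>)) / of_nat (card T))"
    unfolding char_def using finT T0
    by (subst integral_distr, simp, simp, subst integral_measure_pmf[of T])
      (auto simp: scaleR_conv_of_real field_simps)
  also have "\<dots> = E * (\<Sum>M\<in>T. z ^ total_cyc n M) / of_nat (card T)"
    using pt by (simp add: sum_divide_distrib sum_distrib_left)
  finally have char: "char (distr (measure_pmf (pmf_of_set T)) borel (\<lambda>M. (genus m n lam M - \<mu>) / \<sigma>)) t =
      E * (\<Sum>M\<in>T. z ^ total_cyc n M) / of_nat (card T)" .
  define X where "X = of_nat c * (z\<^sup>2 * pochhammer z n' * pochhammer z n ^ Suc k)"
  \<comment> \<open>The 2 in \<open>E\<close> comes from the constant 1 of the genus and cancels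
    \<open>z\<^sup>2\<close> exactly. The rest of the phase is shared equally by the
    \<open>m - 1 = k + 2\<close> factors.\<close>
  have "E * z\<^sup>2 = iexp (- (\<theta> * L)) ^ (Suc (Suc k))"
    unfolding E_def z_def exp_of_nat_mult[symmetric] exp_add[symmetric]
    by (rule arg_cong[where f = exp]) (simp add: k algebra_simps)
  then have "E * X / of_nat (card T) = iexp (- (\<theta> * L)) ^ (Suc (Suc k)) *
      (of_nat c * pochhammer z n' * pochhammer z n ^ Suc k) / of_nat (card T)"
    unfolding X_def by (simp add: mult_ac)
  also have "\<dots> = (iexp (- (\<theta> * L)) * (pochhammer z n' / fact n')) *
      (iexp (- (\<theta> * L)) * (pochhammer z n / fact n)) ^ Suc k"
    unfolding cardT using \<open>c > 0\<close> by (simp add: power_mult_distrib power_divide mult_ac)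
  finally have lim: "(iexp (- (\<theta> * L)) * (pochhammer z n' / fact n')) *
      (iexp (- (\<theta> * L)) * (pochhammer z n / fact n)) ^ Suc k = E * X / of_nat (card T)" ..
  have "norm (E * (\<Sum>M\<in>T. z ^ total_cyc n M) / of_nat (card T) - E * X / of_nat (card T)) =
      norm ((\<Sum>M\<in>T. z ^ total_cyc n M) - X) / card T"
    unfolding diff_divide_distrib[symmetric] right_diff_distrib[symmetric]
    by (simp add: norm_mult norm_divide E_def)
  also have "\<dots> \<le> norm (z - 1)"
    using tuples_generating_function_approx[OF \<open>norm z = 1\<close>, of n' k lam] \<open>card T > 0\<close>
    unfolding T_def X_def c_def k n' by (simp add: divide_le_eq mult.commute)
  also have "\<dots> \<le> \<bar>\<theta>\<bar>" unfolding z_def by (rule norm_iexp_sub_1_le)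
  finally show ?thesis
    using char lim unfolding T_def L_def z_def n' by simp
qed

theorem theorem4p4:
  fixes m :: nat and lam :: "nat \<Rightarrow> nat multiset" and \<mu> \<sigma> :: "nat \<Rightarrow> real"
  assumes "m \<ge> 3"
    and "\<And>n. n \<ge> 1 \<Longrightarrow> is_partition (lam n) n"
    and "\<And>n. \<mu> n = ((real m - 1) * real n - real (size (lam n))) / 2
                    - (real m - 1) / 2 * ln (real n)"
    and "\<And>n. \<sigma> n = sqrt ((real m - 1) / 4 * ln (real n))"
  shows "weak_conv_m
    (\<lambda>n. distr (measure_pmf (pmf_of_set (tuples m n (lam n)))) borel
            (\<lambda>M. (genus m n (lam n) M - \<mu> n) / \<sigma> n))
    std_normal_distribution"
proof (rule levy_continuity)
  show "real_distribution (distr (measure_pmf (pmf_of_set (tuples m n (lam n)))) borel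
            (\<lambda>M. (genus m n (lam n) M - \<mu> n) / \<sigma> n))" for n
    by (intro prob_space.real_distribution_distr measure_pmf.prob_space_axioms) simp
  show "real_distribution std_normal_distribution" by (rule real_dist_normal_dist)
  fix t :: real
  \<comment> \<open>\<open>m \<ge> 3\<close> leaves at least one free permutation beside the full
    cycle and the solved entry; it supplies the averaging.\<close>
  obtain k where k: "m = Suc k + 2" using assms(1) by (metis Suc_le_D add_2_eq_Suc' numeral_3_eq_3 Suc_le_mono add_Suc)
  \<comment> \<open>Chosen so that \<open>(m - 1) * a\<^sup>2 = t\<^sup>2\<close>: each of the
    \<open>m - 1\<close> factors contributes an equal share of the Gaussian exponent.\<close>
  define a where "a = - t / sqrt (real m - 1)"
  define \<theta> where "\<theta> n = a / sqrt (ln (real n))" for n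
  define e where "e = complex_of_real (exp (- (a\<^sup>2) / 2))"
  let ?char = "\<lambda>n. char (distr (measure_pmf (pmf_of_set (tuples m n (lam n)))) borel
            (\<lambda>M. (genus m n (lam n) M - \<mu> n) / \<sigma> n)) t"
  let ?P = "\<lambda>n. (iexp (- (\<theta> n * ln (real n))) * (pochhammer (iexp (\<theta> n)) (n - 1) / fact (n - 1))) *
    (iexp (- (\<theta> n * ln (real n))) * (pochhammer (iexp (\<theta> n)) n / fact n)) ^ Suc k"
  have "?P \<longlonglongrightarrow> e * e ^ Suc k"
    unfolding e_def
    by (intro tendsto_mult tendsto_power pochhammer_iexp_tendsto[OF \<theta>_def]
        pochhammer_iexp_tendsto'[OF \<theta>_def])
  moreover have "(\<lambda>n. ?char n - ?P n) \<longlonglongrightarrow> 0"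
  proof (rule Lim_null_comparison)
    show "eventually (\<lambda>n. norm (?char n - ?P n) \<le> \<bar>\<theta> n\<bar>) sequentially"
      using eventually_ge_at_top[of 2]
      by eventually_elim (rule char_genus_approx[OF k assms(2) _ assms(3,4)],
          auto simp: \<theta>_def a_def)
    show "(\<lambda>n. \<bar>\<theta> n\<bar>) \<longlonglongrightarrow> 0" using tendsto_rabs[OF theta_tendsto_0[OF \<theta>_def]] by simp
  qed
  ultimately have "?char \<longlonglongrightarrow> e * e ^ Suc k"
    using tendsto_add by fastforce
  moreover have "e * e ^ Suc k = char std_normal_distribution t"
  proof -
    have "e * e ^ Suc k = of_real (exp (real (Suc (Suc k)) * (- (a\<^sup>2) / 2)))"
      unfolding e_def exp_of_nat_mult by simp
    also have "real (Suc (Suc k)) * (- (a\<^sup>2) / 2) = - (t\<^sup>2) / 2"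
      by (simp add: a_def k power_divide field_simps)
    finally show ?thesis by (simp add: char_std_normal_distribution)
  qed
  ultimately show "?char \<longlonglongrightarrow> char std_normal_distribution t" by simp
qed


end
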